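(* Let $c>0$ and put $\epsilon_n = c\sqrt{\log(n)/n}$ for those integers $n\ge 2$ with $\epsilon_n<1$. There exist, for each such $n$, points $\boldsymbol{x}_{1,u},\dots,\boldsymbol{x}_{n,u}\in T^u_{\epsilon_n}$ and $\boldsymbol{x}_{1,d},\dots,\boldsymbol{x}_{n,d}\in T^d_{\epsilon_n}$ (depending on $n$ and $\epsilon_n$, but not on the integrand) such that, for every $0<A<1$ and every function $f$ on $[0,1]^2$ with a diagonal singularity no worse than $|x_1-x_2|^{-A}$, the estimate $$\hat\mu_n = \frac{\mathrm{vol}(T^u_{\epsilon_n})}{n}\sum_{i=1}^n f(\boldsymbol{x}_{i,u}) + \frac{\mathrm{vol}(T^d_{\epsilon_n})}{n}\sum_{i=1}^n f(\boldsymbol{x}_{i,d})$$ of $\mu=\int_{[0,1]^2} f(\boldsymbol{x})\,\mathrm{d}\boldsymbol{x}$ satisfies $$|\hat\mu_n-\mu| = O\Bigl(\Bigl(\frac{\log(n)}{n}\Bigr)^{(1-A)/2}\Bigr)\quad\text{as } n\to\infty,$$ where the implied constant may depend on $f$, $A$ and $c$.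
   Context: A function $f$ defined on $[0,1]^2$ has a diagonal singularity no worse than $|x_1-x_2|^{-A}$, for $0<A<1$, if there is a constant $B<\infty$ such that, for all $\boldsymbol{x}=(x_1,x_2)\in[0,1]^2$ with $x_1\ne x_2$, $$|f(\boldsymbol{x})|\le B|x_1-x_2|^{-A},\qquad \Bigl|\frac{\partial f(\boldsymbol{x})}{\partial x_j}\Bigr|\le B|x_1-x_2|^{-A-1}\ (j\in\{1,2\}),\qquad \Bigl|\frac{\partial^2 f(\boldsymbol{x})}{\partial x_j\partial x_k}\Bigr|\le B|x_1-x_2|^{-A-2}\ (j,k\in\{1,2\}).$$ (The values of $f$ on the diagonal $x_1=x_2$ are irrelevant.) For $0<\epsilon<1$ the two triangles are $$T^u_\epsilon=\{\boldsymbol{x}\in[0,1]^2 : x_2\ge x_1+\epsilon\},\qquad T^d_\epsilon=\{\boldsymbol{x}\in[0,1]^2 : x_2\le x_1-\epsilon\},$$ and $\mathrm{vol}$ denotes area (two-dimensional Lebesgue measure). *)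

theory Defs
  imports "HOL-Analysis.Analysis" "HOL-Library.Landau_Symbols"
begin

definition unit_square :: "(real \<times> real) set" where
  "unit_square = {0..1} \<times> {0..1}"

definition coord :: "nat \<Rightarrow> real \<times> real \<Rightarrow> real" where
  "coord j x = (if j = 1 then fst x else snd x)"

definition set_coord :: "nat \<Rightarrow> real \<times> real \<Rightarrow> real \<Rightarrow> real \<times> real" where
  "set_coord j x t = (if j = 1 then (t, snd x) else (fst x, t))"

text \<open>
  Coordinates are numbered 1 and 2. The partial derivative is taken within the unit interval,
  so on the boundary of the square it is the one-sided derivative and values outside the square
  play no role. At a point off the diagonal the values on the diagonal play no role either.
\<close>

definition has_partial_deriv ::
  "nat \<Rightarrow> (real \<times> real \<Rightarrow> real) \<Rightarrow> real \<Rightarrow> real \<times> real \<Rightarrow> bool" where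
  "has_partial_deriv j f D x \<longleftrightarrow>
     ((\<lambda>t. f (set_coord j x t)) has_real_derivative D) (at (coord j x) within {0..1})"

text \<open>
  Existence of all first and second order partial derivatives off the diagonal is part of the
  condition; \<open>Df k\<close> is the partial derivative in coordinate \<open>k\<close>, and \<open>D2f j k\<close> is the partial
  derivative of \<open>Df k\<close> in coordinate \<open>j\<close>. Off the diagonal both are uniquely determined by \<open>f\<close>.
\<close>

definition diagonal_singularity :: "(real \<times> real \<Rightarrow> real) \<Rightarrow> real \<Rightarrow> bool" where
  "diagonal_singularity f A \<longleftrightarrow>
     (\<exists>(B :: real) (Df :: nat \<Rightarrow> real \<times> real \<Rightarrow> real) (D2f :: nat \<Rightarrow> nat \<Rightarrow> real \<times> real \<Rightarrow> real).
        \<forall>x \<in> unit_square. fst x \<noteq> snd x \<longrightarrow>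
          \<bar>f x\<bar> \<le> B * \<bar>fst x - snd x\<bar> powr (- A) \<and>
          (\<forall>j \<in> {1, 2}. has_partial_deriv j f (Df j x) x \<and>
             \<bar>Df j x\<bar> \<le> B * \<bar>fst x - snd x\<bar> powr (- A - 1)) \<and>
          (\<forall>j \<in> {1, 2}. \<forall>k \<in> {1, 2}. has_partial_deriv j (Df k) (D2f j k x) x \<and>
             \<bar>D2f j k x\<bar> \<le> B * \<bar>fst x - snd x\<bar> powr (- A - 2)))"

definition upper_triangle :: "real \<Rightarrow> (real \<times> real) set" where
  "upper_triangle \<epsilon> = {x \<in> unit_square. snd x \<ge> fst x + \<epsilon>}"

definition lower_triangle :: "real \<Rightarrow> (real \<times> real) set" where
  "lower_triangle \<epsilon> = {x \<in> unit_square. snd x \<le> fst x - \<epsilon>}"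

definition eps :: "real \<Rightarrow> nat \<Rightarrow> real" where
  "eps c n = c * sqrt (ln (real n) / real n)"

text \<open>
  The integral is taken with respect to the completed measure: \<open>f\<close> is arbitrary on the diagonal,
  hence possibly not Borel measurable, but the diagonal is a null set.
\<close>

definition square_integral :: "(real \<times> real \<Rightarrow> real) \<Rightarrow> real" where
  "square_integral f = set_lebesgue_integral lebesgue unit_square f"

definition two_triangle_estimate ::
  "real \<Rightarrow> nat \<Rightarrow> (nat \<Rightarrow> real \<times> real) \<Rightarrow> (nat \<Rightarrow> real \<times> real) \<Rightarrow> (real \<times> real \<Rightarrow> real) \<Rightarrow> real" where
  "two_triangle_estimate \<epsilon> n u d f =
     measure lebesgue (upper_triangle \<epsilon>) / real n * (\<Sum>i=1..n. f (u i)) +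
     measure lebesgue (lower_triangle \<epsilon>) / real n * (\<Sum>i=1..n. f (d i))"

end

theory Submission
  imports Defs
begin

text \<open>
  Call \<open>snd z - fst z\<close> the gap of a point \<open>z\<close> above the diagonal. A function of the gap alone
  integrates over the square to at most its one-dimensional integral (\<open>gap_integral\<close>), so the
  singularity behaves like a one-dimensional one: the part of the integral of \<open>f\<close> with gap below
  a multiple of \<open>\<epsilon>\<close> is \<open>O(\<epsilon> powr (1 - A))\<close>, and this is the rate that is claimed. It remains to
  find \<open>n\<close> equally weighted points in the triangle whose error is of the same order.

  Let \<open>h\<close> be the side for which \<open>n\<close> squares of side \<open>h\<close> have the area of the triangle, and put a grid
  of such squares into the corner \<open>(0, 1)\<close> opposite to the diagonal. Each square that fits into the
  triangle contributes its vertex farthest from the diagonal as a sample point, with the correct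
  weight \<open>h\<^sup>2\<close>. Walking from that vertex to any point of the square never makes the gap smaller
  than the gap \<open>t\<close> at the end point, so \<open>f\<close> changes by at most \<open>2 * h * B * t powr (- A - 1)\<close>
  (\<open>upper_growth_lipschitz\<close>). Integrated over the gaps \<open>t \<ge> \<epsilon>\<close> this gives \<open>O(h * \<epsilon> powr (- A))\<close>.
  The points outside the squares have gap below \<open>\<epsilon> + 2 * h\<close>, so that their contribution is covered by
  the first paragraph (\<open>cell_sum_error\<close>).

  The squares have total area at least that of the triangle minus \<open>2 * h\<close>, hence all but at
  most \<open>2 / h\<close> of the \<open>n\<close> sample points are accounted for (\<open>card_inner_cells\<close>). The remaining ones are
  placed at \<open>(0, 1)\<close>, where \<open>f\<close> is bounded by \<open>B\<close>; they contribute at most \<open>2 * h * B\<close>.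

  Finally \<open>h \<le> 1 / sqrt n\<close>, which is eventually at most \<open>\<epsilon> = c * sqrt (ln n / n)\<close>, so every error term
  is \<open>O(\<epsilon> powr (1 - A))\<close>. The lower triangle follows by exchanging the two coordinates.
\<close>

section \<open>Functions with bounded growth towards the diagonal\<close>

definition strict_upper :: "(real \<times> real) set" where
  "strict_upper = {z. 0 \<le> fst z \<and> fst z < snd z \<and> snd z \<le> 1}"

text \<open>
  The bounds on the part of the square above the diagonal. Below the diagonal the same
  condition is imposed on \<open>f \<circ> prod.swap\<close>, so that only one triangle has to be analysed.
\<close>

definition upper_growth :: "real \<Rightarrow> real \<Rightarrow> (real \<times> real \<Rightarrow> real) \<Rightarrow> bool" where
  "upper_growth A B f \<longleftrightarrow> (\<forall>x y. 0 \<le> x \<and> x < y \<and> y \<le> 1 \<longrightarrow>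
     \<bar>f (x, y)\<bar> \<le> B * (y - x) powr (- A) \<and>
     (\<exists>D. ((\<lambda>t. f (t, y)) has_real_derivative D) (at x within {0..1}) \<and>
          \<bar>D\<bar> \<le> B * (y - x) powr (- A - 1)) \<and>
     (\<exists>D. ((\<lambda>t. f (x, t)) has_real_derivative D) (at y within {0..1}) \<and>
          \<bar>D\<bar> \<le> B * (y - x) powr (- A - 1)))"

lemma diagonal_singularity_upper_growth:
  assumes "diagonal_singularity f A"
  obtains B where "upper_growth A B f" "upper_growth A B (f \<circ> prod.swap)"
proof -
  obtain B Df where *: "\<And>x. x \<in> unit_square \<Longrightarrow> fst x \<noteq> snd x \<Longrightarrow>
      \<bar>f x\<bar> \<le> B * \<bar>fst x - snd x\<bar> powr (- A) \<and>
      (\<forall>j \<in> {1, 2::nat}. has_partial_deriv j f (Df j x) x \<and>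
             \<bar>Df j x\<bar> \<le> B * \<bar>fst x - snd x\<bar> powr (- A - 1))"
    using assms unfolding diagonal_singularity_def by blast
  have "upper_growth A B f"
    unfolding upper_growth_def
  proof (intro allI impI conjI)
    fix x y :: real
    assume "0 \<le> x \<and> x < y \<and> y \<le> 1"
    then have "(x, y) \<in> unit_square" "x \<noteq> y" "\<bar>x - y\<bar> = y - x" by (auto simp: unit_square_def)
    with *[of "(x, y)"] show
      "\<bar>f (x, y)\<bar> \<le> B * (y - x) powr (- A)"
      "\<exists>D. ((\<lambda>t. f (t, y)) has_real_derivative D) (at x within {0..1}) \<and>
          \<bar>D\<bar> \<le> B * (y - x) powr (- A - 1)"
      "\<exists>D. ((\<lambda>t. f (x, t)) has_real_derivative D) (at y within {0..1}) \<and>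
          \<bar>D\<bar> \<le> B * (y - x) powr (- A - 1)"
      by (auto simp: has_partial_deriv_def coord_def set_coord_def)
  qed
  moreover have "upper_growth A B (f \<circ> prod.swap)"
    unfolding upper_growth_def
  proof (intro allI impI conjI)
    fix x y :: real
    assume "0 \<le> x \<and> x < y \<and> y \<le> 1"
    then have "(y, x) \<in> unit_square" "x \<noteq> y" "\<bar>y - x\<bar> = y - x" by (auto simp: unit_square_def)
    with *[of "(y, x)"] show
      "\<bar>(f \<circ> prod.swap) (x, y)\<bar> \<le> B * (y - x) powr (- A)"
      "\<exists>D. ((\<lambda>t. (f \<circ> prod.swap) (t, y)) has_real_derivative D) (at x within {0..1}) \<and>
          \<bar>D\<bar> \<le> B * (y - x) powr (- A - 1)"
      "\<exists>D. ((\<lambda>t. (f \<circ> prod.swap) (x, t)) has_real_derivative D) (at y within {0..1}) \<and>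
          \<bar>D\<bar> \<le> B * (y - x) powr (- A - 1)"
      by (auto simp: has_partial_deriv_def coord_def set_coord_def)
  qed
  ultimately show ?thesis by (rule that)
qed

lemma upper_growth_nonneg:
  assumes "upper_growth A B f"
  shows "0 \<le> B"
  using assms[unfolded upper_growth_def, rule_format, of 0 1] by (auto dest: order_trans[OF abs_ge_zero])

text \<open>
  The points are joined by a horizontal and a vertical segment. The largest first
  and the smallest second coordinate bound the gap along this path from below, so both
  segments avoid the diagonal and the mean value theorem applies to each of them.
\<close>

lemma upper_growth_lipschitz:
  assumes f: "upper_growth A B f" and A: "0 < A" and \<delta>: "0 < \<delta>"
    and xy: "0 \<le> x" "0 \<le> x'" "y \<le> 1" "y' \<le> 1"
    and gap: "\<delta> \<le> min y y' - max x x'"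
  shows "\<bar>f (x', y') - f (x, y)\<bar> \<le> B * \<delta> powr (- A - 1) * (\<bar>x' - x\<bar> + \<bar>y' - y\<bar>)"
proof -
  have slope: "\<bar>D\<bar> \<le> B * \<delta> powr (- A - 1)"
    if "\<delta> \<le> t - s" "\<bar>D\<bar> \<le> B * (t - s) powr (- A - 1)" for D s t
  proof -
    have "(t - s) powr (- A - 1) \<le> \<delta> powr (- A - 1)"
      using that \<delta> A by (intro powr_mono2') auto
    then show ?thesis
      using that upper_growth_nonneg[OF f] by (meson mult_left_mono order_trans)
  qed
  have "\<bar>f (x', y) - f (x, y)\<bar> \<le> B * \<delta> powr (- A - 1) * \<bar>x' - x\<bar>"
  proof -
    have "\<exists>D. ((\<lambda>t. f (t, y)) has_real_derivative D) (at s within {min x x'..max x x'}) \<and>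
          \<bar>D\<bar> \<le> B * \<delta> powr (- A - 1)" if s: "s \<in> {min x x'..max x x'}" for s
    proof -
      have "0 \<le> s" "\<delta> \<le> y - s" using s xy gap by (auto simp: min_def max_def split: if_splits)
      with \<delta> xy obtain D where "((\<lambda>t. f (t, y)) has_real_derivative D) (at s within {0..1})"
          "\<bar>D\<bar> \<le> B * (y - s) powr (- A - 1)"
        using f[unfolded upper_growth_def, rule_format, of s y] by auto
      moreover have "{min x x'..max x x'} \<subseteq> {0..1}"
        using xy gap \<delta> by (auto simp: min_def max_def split: if_splits)
      ultimately show ?thesis
        using slope \<open>\<delta> \<le> y - s\<close> DERIV_subset by blast
    qed
    then obtain D where D: "\<And>s. s \<in> {min x x'..max x x'} \<Longrightarrow>
       ((\<lambda>t. f (t, y)) has_real_derivative D s) (at s within {min x x'..max x x'}) \<and>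
          \<bar>D s\<bar> \<le> B * \<delta> powr (- A - 1)" by metis
    show ?thesis
      using field_differentiable_bound[of "{min x x'..max x x'}" "\<lambda>t. f (t, y)" D "B * \<delta> powr (- A - 1)" x' x] D
      by auto
  qed
  moreover have "\<bar>f (x', y') - f (x', y)\<bar> \<le> B * \<delta> powr (- A - 1) * \<bar>y' - y\<bar>"
  proof -
    have "\<exists>D. ((\<lambda>t. f (x', t)) has_real_derivative D) (at s within {min y y'..max y y'}) \<and>
          \<bar>D\<bar> \<le> B * \<delta> powr (- A - 1)" if s: "s \<in> {min y y'..max y y'}" for s
    proof -
      have "s \<le> 1" "\<delta> \<le> s - x'" using s xy gap by (auto simp: min_def max_def split: if_splits)
      with \<delta> xy obtain D where "((\<lambda>t. f (x', t)) has_real_derivative D) (at s within {0..1})"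
          "\<bar>D\<bar> \<le> B * (s - x') powr (- A - 1)"
        using f[unfolded upper_growth_def, rule_format, of x' s] by auto
      moreover have "{min y y'..max y y'} \<subseteq> {0..1}"
        using xy gap \<delta> by (auto simp: min_def max_def split: if_splits)
      ultimately show ?thesis
        using slope \<open>\<delta> \<le> s - x'\<close> DERIV_subset by blast
    qed
    then obtain D where D: "\<And>s. s \<in> {min y y'..max y y'} \<Longrightarrow>
       ((\<lambda>t. f (x', t)) has_real_derivative D s) (at s within {min y y'..max y y'}) \<and>
          \<bar>D s\<bar> \<le> B * \<delta> powr (- A - 1)" by metis
    show ?thesis
      using field_differentiable_bound[of "{min y y'..max y y'}" "\<lambda>t. f (x', t)" D "B * \<delta> powr (- A - 1)" y' y] D
      by auto
  qed
  ultimately show ?thesis by (simp add: algebra_simps)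
qed

text \<open>
  This provides measurability: \<open>f\<close> is not assumed to be measurable, but above the diagonal the
  local Lipschitz bound makes it continuous.
\<close>

lemma upper_growth_continuous_on:
  assumes f: "upper_growth A B f" and A: "0 < A"
  shows "continuous_on strict_upper f"
  unfolding continuous_on_def
proof
  fix z assume z: "z \<in> strict_upper"
  obtain x y where xy: "z = (x, y)" by (cases z)
  \<comment> \<open>Points closer than half of this to \<open>z\<close> still have a common gap of at least \<open>\<delta>\<close> with it.\<close>
  define \<delta> where "\<delta> = (y - x) / 2"
  have \<delta>: "0 < \<delta>" using z xy by (auto simp: \<delta>_def strict_upper_def)
  let ?g = "\<lambda>w. B * \<delta> powr (- A - 1) * (\<bar>fst w - x\<bar> + \<bar>snd w - y\<bar>)"
  have "(?g \<longlongrightarrow> B * \<delta> powr (- A - 1) * (\<bar>fst z - x\<bar> + \<bar>snd z - y\<bar>)) (at z within strict_upper)"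
    by (intro tendsto_intros)
  then have g0: "(?g \<longlongrightarrow> 0) (at z within strict_upper)" by (simp add: xy)
  have near: "\<forall>\<^sub>F w in at z within strict_upper. dist (f w) (f z) \<le> ?g w"
    unfolding eventually_at
  proof (intro exI[of _ "\<delta> / 2"] conjI ballI impI)
    fix w assume w: "w \<in> strict_upper" "w \<noteq> z \<and> dist w z < \<delta> / 2"
    obtain x' y' where xy': "w = (x', y')" by (cases w)
    have "\<bar>x' - x\<bar> < \<delta> / 2" "\<bar>y' - y\<bar> < \<delta> / 2"
      using w dist_fst_le[of w z] dist_snd_le[of w z] by (auto simp: xy xy' dist_real_def)
    then have "\<delta> \<le> min y y' - max x x'" using \<delta> by (auto simp: \<delta>_def min_def max_def)
    then show "dist (f w) (f z) \<le> ?g w"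
      using upper_growth_lipschitz[OF f A \<delta>, of x x' y y'] w z
      by (auto simp: xy xy' strict_upper_def dist_real_def)
  qed (use \<delta> in auto)
  show "(f \<longlongrightarrow> f z) (at z within strict_upper)"
    unfolding tendsto_dist_iff[of f] using near by (intro Lim_null_comparison[OF _ g0]) simp
qed

lemma strict_upper_borel [measurable]: "strict_upper \<in> sets borel"
proof -
  have "strict_upper = {z. 0 \<le> fst z} \<inter> {z. fst z < snd z} \<inter> {z. snd z \<le> 1}"
    by (auto simp: strict_upper_def)
  also have "\<dots> \<in> sets borel"
    by (intro sets.Int borel_closed borel_open closed_Collect_le open_Collect_less continuous_intros)
  finally show ?thesis .
qed

section \<open>Integrals of functions of the gap\<close>

text \<open>
  By Tonelli's theorem and translation invariance: for each fixed first coordinate the inner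
  integral is at most the integral of \<open>w\<close> over the line.
\<close>

lemma gap_integral:
  fixes w :: "real \<Rightarrow> real"
  assumes w: "integrable lborel w" and pos: "\<And>t. 0 \<le> w t"
  shows "set_integrable lborel unit_square (\<lambda>z. w (snd z - fst z))"
    and "(LINT z:unit_square|lborel. w (snd z - fst z)) \<le> (LINT t|lborel. w t)"
proof -
  have [measurable]: "w \<in> borel_measurable borel" using w by auto
  have sq: "unit_square \<in> sets borel"
    unfolding unit_square_def by (intro borel_closed closed_Times) auto
  have [measurable]: "(\<lambda>z::real \<times> real. snd z - fst z) \<in> borel_measurable borel"
    by (intro borel_measurable_continuous_onI continuous_intros)
  have meas: "(\<lambda>z. indicator unit_square z *\<^sub>R w (snd z - fst z)) \<in> borel_measurable lborel"
    using sq by measurable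
  have "(\<integral>\<^sup>+z. ennreal (indicator unit_square z *\<^sub>R w (snd z - fst z)) \<partial>lborel)
     = (\<integral>\<^sup>+z. ennreal (indicator unit_square z *\<^sub>R w (snd z - fst z)) \<partial>(lborel \<Otimes>\<^sub>M lborel))"
    by (simp add: lborel_prod)
  also have "\<dots> = (\<integral>\<^sup>+x. \<integral>\<^sup>+y. ennreal (indicator unit_square (x, y) *\<^sub>R w (y - x)) \<partial>lborel \<partial>lborel)"
    using meas by (subst lborel.nn_integral_fst[symmetric]) (auto simp: lborel_prod)
  also have "\<dots> \<le> (\<integral>\<^sup>+x. indicator {0..1} x * (\<integral>\<^sup>+y. ennreal (w (y - x)) \<partial>lborel) \<partial>lborel)"
    by (intro nn_integral_mono, subst nn_integral_cmult[symmetric], measurable, intro nn_integral_mono)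
       (auto simp: indicator_def unit_square_def pos)
  also have "\<dots> = (\<integral>\<^sup>+x. indicator {0..1::real} x * (\<integral>\<^sup>+t. ennreal (w t) \<partial>lborel) \<partial>lborel)"
  proof -
    have "(\<integral>\<^sup>+y. ennreal (w (y - x)) \<partial>lborel) = (\<integral>\<^sup>+t. ennreal (w t) \<partial>lborel)" for x
      using nn_integral_real_affine[of "\<lambda>t. ennreal (w t)" 1 "- x"] by simp
    then show ?thesis by simp
  qed
  also have "\<dots> = (\<integral>\<^sup>+t. ennreal (w t) \<partial>lborel)"
    by (subst nn_integral_multc) auto
  also have "\<dots> = ennreal (LINT t|lborel. w t)"
    using w pos by (intro nn_integral_eq_integral) auto
  finally have le: "(\<integral>\<^sup>+z. ennreal (indicator unit_square z *\<^sub>R w (snd z - fst z)) \<partial>lborel)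
      \<le> ennreal (LINT t|lborel. w t)" .
  show int: "set_integrable lborel unit_square (\<lambda>z. w (snd z - fst z))"
    unfolding set_integrable_def
    using meas le pos by (intro integrableI_nonneg) (auto intro: le_less_trans)
  show "(LINT z:unit_square|lborel. w (snd z - fst z)) \<le> (LINT t|lborel. w t)"
    using le nn_integral_eq_integral[OF int[unfolded set_integrable_def]] pos
    unfolding set_lebesgue_integral_def by (simp add: ennreal_le_iff integral_nonneg_AE)
qed

lemma has_integral_imp_has_bochner_integral_nonneg:
  fixes w :: "real \<Rightarrow> real"
  assumes "(w has_integral I) S" "\<And>t. t \<in> S \<Longrightarrow> 0 \<le> w t"
    "w \<in> borel_measurable borel" "S \<in> sets borel"
  shows "has_bochner_integral lborel (\<lambda>t. indicator S t * w t) I"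
proof -
  have "0 \<le> I" using has_integral_nonneg assms by blast
  have "(\<integral>\<^sup>+ t. ennreal (indicator S t * w t) \<partial>lborel) = ennreal I"
    using nn_integral_has_integral_lebesgue[OF assms(2,1)] .
  then show ?thesis
    using assms \<open>0 \<le> I\<close> by (intro has_bochner_integral_nn_integral) (auto simp: indicator_def)
qed

lemma has_bochner_integral_powr_near_0:
  fixes A b :: real
  assumes "A < 1" "0 \<le> b"
  shows "has_bochner_integral lborel (\<lambda>t. indicator {0..b} t * t powr (- A)) (b powr (1 - A) / (1 - A))"
  using has_integral_powr_from_0[of "- A" b] assms
  by (intro has_integral_imp_has_bochner_integral_nonneg) (auto simp: algebra_simps)

lemma has_bochner_integral_powr_tail:
  fixes A a :: real
  assumes "0 < A" "0 < a"
  shows "has_bochner_integral lborel (\<lambda>t. indicator {a..} t * t powr (- A - 1)) (a powr (- A) / A)"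
  using has_integral_powr_to_inf[of "- A - 1" a] assms
  by (intro has_integral_imp_has_bochner_integral_nonneg) (auto simp: algebra_simps)

text \<open>
  The dominating function is \<open>B * t powr (- A)\<close> of the gap \<open>t\<close>, integrable because \<open>A < 1\<close>.
\<close>

lemma upper_growth_set_integrable:
  assumes f: "upper_growth A B f" and A: "0 < A" "A < 1"
  shows "set_integrable lborel strict_upper f"
proof -
  let ?w = "\<lambda>t. B * (indicator {0..1} t * t powr (- A))"
  have "integrable lborel ?w"
    using has_bochner_integral_powr_near_0[of A 1] A by (intro integrable_mult_right) (auto simp: has_bochner_integral_iff)
  from gap_integral(1)[OF this] upper_growth_nonneg[OF f]
  have dom: "set_integrable lborel unit_square (\<lambda>z. ?w (snd z - fst z))" by auto
  show ?thesis
    unfolding set_integrable_def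
  proof (rule Bochner_Integration.integrable_bound[OF dom[unfolded set_integrable_def]])
    show "(\<lambda>z. indicator strict_upper z *\<^sub>R f z) \<in> borel_measurable lborel"
      using borel_measurable_continuous_on_indicator[OF _ upper_growth_continuous_on[OF f A(1)]]
      by simp
    show "AE z in lborel. norm (indicator strict_upper z *\<^sub>R f z) \<le>
       norm (indicator unit_square z *\<^sub>R (?w (snd z - fst z)))"
    proof (rule AE_I2)
      fix z :: "real \<times> real"
      obtain x y where z: "z = (x, y)" by (cases z)
      show "norm (indicator strict_upper z *\<^sub>R f z) \<le>
       norm (indicator unit_square z *\<^sub>R (?w (snd z - fst z)))"
        using f[unfolded upper_growth_def, rule_format, of x y] upper_growth_nonneg[OF f]
        by (auto simp: indicator_def strict_upper_def unit_square_def z)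
    qed
  qed
qed

section \<open>The grid of squares in the upper triangle\<close>

text \<open>
  The grid is indexed from the corner \<open>(0, 1)\<close> rightwards and downwards. The squares are half open,
  so that they partition the region to the right of and below that corner.
\<close>

definition cell :: "real \<Rightarrow> nat \<times> nat \<Rightarrow> (real \<times> real) set" where
  "cell h p = {real (fst p) * h..<(real (fst p) + 1) * h} \<times> {1 - (real (snd p) + 1) * h<..1 - real (snd p) * h}"

text \<open>
  The vertex farthest from the diagonal, and the one that belongs to the half open square.
\<close>

definition corner :: "real \<Rightarrow> nat \<times> nat \<Rightarrow> real \<times> real" where
  "corner h p = (real (fst p) * h, 1 - real (snd p) * h)"

text \<open>
  In the coordinates \<open>fst z\<close> and \<open>1 - snd z\<close> the triangle is given by a bound \<open>1 - \<epsilon>\<close> on their sum,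
  and the condition says that the vertex closest to the diagonal satisfies it.
\<close>

definition inner_cells :: "real \<Rightarrow> real \<Rightarrow> (nat \<times> nat) set" where
  "inner_cells h \<epsilon> = {p. real (fst p + snd p + 2) * h \<le> 1 - \<epsilon>}"

lemma has_bochner_integral_cell:
  assumes "0 < h"
  shows "has_bochner_integral lborel (indicator (cell h p) :: _ \<Rightarrow> real) (h\<^sup>2)"
proof -
  have "emeasure lborel (cell h p) = emeasure lborel {real (fst p) * h..<(real (fst p) + 1) * h}
      * emeasure lborel {1 - (real (snd p) + 1) * h<..1 - real (snd p) * h}"
    unfolding cell_def lborel_prod[symmetric] by (intro lborel.emeasure_pair_measure_Times) auto
  also have "\<dots> = ennreal (h\<^sup>2)"
    using assms by (simp add: algebra_simps power2_eq_square ennreal_mult)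
  finally have e: "emeasure lborel (cell h p) = ennreal (h\<^sup>2)" .
  then have "measure lborel (cell h p) = h\<^sup>2" by (simp add: measure_def)
  moreover have "cell h p \<in> sets lborel"
    unfolding cell_def lborel_prod[symmetric] by (intro pair_measureI) auto
  ultimately show ?thesis
    using has_bochner_integral_real_indicator[of "cell h p" lborel] e by simp
qed

lemma cell_index:
  assumes "0 < h" "z \<in> cell h p"
  shows "p = (nat \<lfloor>fst z / h\<rfloor>, nat \<lfloor>(1 - snd z) / h\<rfloor>)"
proof -
  have "real (fst p) \<le> fst z / h" "fst z / h < real (fst p) + 1"
    "real (snd p) \<le> (1 - snd z) / h" "(1 - snd z) / h < real (snd p) + 1"
    using assms(2) unfolding pos_le_divide_eq[OF assms(1)] pos_divide_less_eq[OF assms(1)]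
    by (auto simp: cell_def)
  then have "\<lfloor>fst z / h\<rfloor> = int (fst p)" "\<lfloor>(1 - snd z) / h\<rfloor> = int (snd p)"
    by linarith+
  then show ?thesis by simp
qed

lemma in_cell:
  assumes "0 < h" "0 \<le> fst z" "snd z \<le> 1"
  shows "z \<in> cell h (nat \<lfloor>fst z / h\<rfloor>, nat \<lfloor>(1 - snd z) / h\<rfloor>)"
proof -
  have "real (nat \<lfloor>fst z / h\<rfloor>) = of_int \<lfloor>fst z / h\<rfloor>"
    "real (nat \<lfloor>(1 - snd z) / h\<rfloor>) = of_int \<lfloor>(1 - snd z) / h\<rfloor>"
    using assms by auto
  moreover have "of_int \<lfloor>fst z / h\<rfloor> * h \<le> fst z" "fst z < (of_int \<lfloor>fst z / h\<rfloor> + 1) * h"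
    "of_int \<lfloor>(1 - snd z) / h\<rfloor> * h \<le> 1 - snd z" "1 - snd z < (of_int \<lfloor>(1 - snd z) / h\<rfloor> + 1) * h"
    by (simp_all only: pos_le_divide_eq[OF assms(1), symmetric] pos_divide_less_eq[OF assms(1), symmetric])
      linarith+
  ultimately show ?thesis
    by (simp add: cell_def mem_Times_iff)
qed

lemma finite_inner_cells:
  assumes "0 < h"
  shows "finite (inner_cells h \<epsilon>)"
proof -
  obtain k :: nat where k: "(1 - \<epsilon>) / h < k" using reals_Archimedean2 by blast
  have "inner_cells h \<epsilon> \<subseteq> {..k} \<times> {..k}"
  proof
    fix p assume "p \<in> inner_cells h \<epsilon>"
    then have "real (fst p + snd p + 2) \<le> (1 - \<epsilon>) / h"
      using assms by (simp add: inner_cells_def pos_le_divide_eq)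
    with k have "real (fst p + snd p + 2) < real k" by linarith
    then have "fst p + snd p + 2 < k" by (simp only: of_nat_less_iff)
    then show "p \<in> {..k} \<times> {..k}" by (simp add: mem_Times_iff)
  qed
  then show ?thesis by (rule finite_subset) simp
qed

lemma inner_cell_upper_triangle:
  assumes "0 < h" "0 < \<epsilon>" "p \<in> inner_cells h \<epsilon>"
  shows "cell h p \<subseteq> upper_triangle \<epsilon>" "corner h p \<in> upper_triangle \<epsilon>"
proof -
  have *: "real (fst p) * h + real (snd p) * h + 2 * h \<le> 1 - \<epsilon>"
    using assms by (simp add: inner_cells_def algebra_simps)
  moreover have **: "0 \<le> real (fst p) * h" "0 \<le> real (snd p) * h" using assms by auto
  ultimately show "corner h p \<in> upper_triangle \<epsilon>"
    using assms unfolding corner_def upper_triangle_def unit_square_def mem_Collect_eq mem_Times_iff fst_conv snd_conv atLeastAtMost_iff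
    by linarith
  show "cell h p \<subseteq> upper_triangle \<epsilon>"
  proof
    fix z assume "z \<in> cell h p"
    then have "real (fst p) * h \<le> fst z" "fst z < real (fst p) * h + h"
      "1 - real (snd p) * h - h < snd z" "snd z \<le> 1 - real (snd p) * h"
      by (auto simp: cell_def algebra_simps)
    with * ** assms show "z \<in> upper_triangle \<epsilon>"
      unfolding upper_triangle_def unit_square_def mem_Collect_eq mem_Times_iff atLeastAtMost_iff
      by linarith
  qed
qed

text \<open>
  The square around such a point reaches beyond the triangle, and the gap varies by at
  most \<open>2 * h\<close> over a square.
\<close>

lemma outside_inner_cells:
  assumes "0 < h" "0 \<le> fst z" "snd z \<le> 1" "\<And>p. p \<in> inner_cells h \<epsilon> \<Longrightarrow> z \<notin> cell h p"
  shows "snd z - fst z < \<epsilon> + 2 * h"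
proof -
  define p where "p = (nat \<lfloor>fst z / h\<rfloor>, nat \<lfloor>(1 - snd z) / h\<rfloor>)"
  have z: "z \<in> cell h p" unfolding p_def using assms by (intro in_cell)
  with assms(4)[of p] have "1 - \<epsilon> < real (fst p + snd p + 2) * h"
    unfolding inner_cells_def mem_Collect_eq not_le[symmetric] by blast
  with z show ?thesis by (auto simp: cell_def mem_Times_iff algebra_simps)
qed

lemma sum_indicator_cells:
  fixes g :: "nat \<times> nat \<Rightarrow> real"
  assumes "0 < h" "p \<in> inner_cells h \<epsilon>" "z \<in> cell h p"
  shows "(\<Sum>q\<in>inner_cells h \<epsilon>. g q * indicator (cell h q) z) = g p"
proof -
  have "z \<in> cell h q \<longleftrightarrow> q = p" for q
    using cell_index[OF assms(1), of z q] cell_index[OF assms(1,3)] assms(3) by metis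
  then have "(\<Sum>q\<in>inner_cells h \<epsilon>. g q * indicator (cell h q) z)
      = (\<Sum>q\<in>inner_cells h \<epsilon>. if q = p then g p else 0)"
    by (intro sum.cong) (auto simp: indicator_def)
  then show ?thesis using assms finite_inner_cells by simp
qed

lemma sum_indicator_outside_cells:
  fixes g :: "nat \<times> nat \<Rightarrow> real"
  assumes "\<And>p. p \<in> inner_cells h \<epsilon> \<Longrightarrow> z \<notin> cell h p"
  shows "(\<Sum>q\<in>inner_cells h \<epsilon>. g q * indicator (cell h q) z) = 0"
  using assms by (intro sum.neutral) auto

lemma has_bochner_integral_cell_step:
  assumes "0 < h"
  shows "has_bochner_integral lborel (\<lambda>z. \<Sum>p\<in>inner_cells h \<epsilon>. g p * indicator (cell h p) z)
      (h\<^sup>2 * (\<Sum>p\<in>inner_cells h \<epsilon>. g p))"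
proof -
  have "has_bochner_integral lborel (\<lambda>z. g p * indicator (cell h p) z) (g p * h\<^sup>2)" for p
    by (intro has_bochner_integral_mult_right has_bochner_integral_cell assms)
  then have "has_bochner_integral lborel (\<lambda>z. \<Sum>p\<in>inner_cells h \<epsilon>. g p * indicator (cell h p) z)
      (\<Sum>p\<in>inner_cells h \<epsilon>. g p * h\<^sup>2)"
    by (intro has_bochner_integral_sum)
  then show ?thesis by (simp add: sum_distrib_right[symmetric] mult.commute[of "h\<^sup>2"])
qed

lemma upper_triangle_borel: "upper_triangle \<epsilon> \<in> sets borel"
proof -
  have "upper_triangle \<epsilon> = {0..1} \<times> {0..1} \<inter> {z. fst z + \<epsilon> \<le> snd z}"
    by (auto simp: upper_triangle_def unit_square_def)
  also have "\<dots> \<in> sets borel"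
    by (intro sets.Int borel_closed closed_Times closed_Collect_le continuous_intros closed_atLeastAtMost)
  finally show ?thesis .
qed

lemma upper_triangle_subset_cbox: "upper_triangle \<epsilon> \<subseteq> cbox (0 :: real, 0 :: real) (1, 1)"
  by (auto simp: upper_triangle_def unit_square_def cbox_Pair_eq)

lemma has_bochner_integral_upper_triangle:
  "has_bochner_integral lborel (indicator (upper_triangle \<epsilon>) :: _ \<Rightarrow> real) (measure lebesgue (upper_triangle \<epsilon>))"
proof -
  have "emeasure lborel (upper_triangle \<epsilon>) \<le> emeasure lborel (cbox (0, 0) (1 :: real, 1 :: real))"
    by (intro emeasure_mono upper_triangle_subset_cbox) simp
  also have "\<dots> < \<infinity>" by (rule emeasure_lborel_cbox_finite)
  finally show ?thesis
    using has_bochner_integral_real_indicator[of "upper_triangle \<epsilon>" lborel] upper_triangle_borel[of \<epsilon>]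
    by simp
qed

lemma has_bochner_integral_le:
  fixes f g :: "'a \<Rightarrow> real"
  assumes "has_bochner_integral M f x" "has_bochner_integral M g y" "\<And>z. f z \<le> g z"
  shows "x \<le> y"
  using assms integral_mono[of M f g] by (auto simp: has_bochner_integral_iff)

text \<open>
  The squares are disjoint subsets of the triangle, and they cover it up to the band of gaps
  between \<open>\<epsilon>\<close> and \<open>\<epsilon> + 2 * h\<close>, which has area at most \<open>2 * h\<close>.
\<close>

lemma card_inner_cells:
  assumes h: "0 < h" and \<epsilon>: "0 < \<epsilon>"
  shows "h\<^sup>2 * card (inner_cells h \<epsilon>) \<le> measure lebesgue (upper_triangle \<epsilon>)"
    and "measure lebesgue (upper_triangle \<epsilon>) \<le> h\<^sup>2 * card (inner_cells h \<epsilon>) + 2 * h"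
proof -
  let ?c = "\<lambda>z. \<Sum>p\<in>inner_cells h \<epsilon>. 1 * indicator (cell h p) z :: real"
  have c: "has_bochner_integral lborel ?c (h\<^sup>2 * card (inner_cells h \<epsilon>))"
    using has_bochner_integral_cell_step[OF h, of "\<lambda>_. 1" \<epsilon>] by simp
  note t = has_bochner_integral_upper_triangle[of \<epsilon>]
  show "h\<^sup>2 * card (inner_cells h \<epsilon>) \<le> measure lebesgue (upper_triangle \<epsilon>)"
  proof (rule has_bochner_integral_le[OF c t])
    fix z
    show "?c z \<le> indicator (upper_triangle \<epsilon>) z"
    proof (cases "\<exists>p\<in>inner_cells h \<epsilon>. z \<in> cell h p")
      case True
      then obtain p where p: "p \<in> inner_cells h \<epsilon>" "z \<in> cell h p" by blast
      then show ?thesis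
        using sum_indicator_cells[OF h p, of "\<lambda>_. 1"] inner_cell_upper_triangle[OF h \<epsilon> p(1)] by auto
    next
      case False
      then show ?thesis using sum_indicator_outside_cells[of h \<epsilon> z "\<lambda>_. 1"] by auto
    qed
  qed
  let ?w = "indicator {\<epsilon>..\<epsilon> + 2 * h} :: real \<Rightarrow> real"
  have w: "has_bochner_integral lborel ?w (2 * h)"
    using has_bochner_integral_real_indicator[of "{\<epsilon>..\<epsilon> + 2 * h}" lborel] h by simp
  note gap = gap_integral[of ?w, unfolded set_integrable_def set_lebesgue_integral_def]
  let ?b = "\<lambda>z. indicator unit_square z *\<^sub>R ?w (snd z - fst z)"
  have b: "has_bochner_integral lborel ?b (integral\<^sup>L lborel ?b)" "integral\<^sup>L lborel ?b \<le> 2 * h"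
    using gap w by (auto simp: has_bochner_integral_iff)
  have "measure lebesgue (upper_triangle \<epsilon>) \<le> h\<^sup>2 * card (inner_cells h \<epsilon>) + integral\<^sup>L lborel ?b"
  proof (rule has_bochner_integral_le[OF t has_bochner_integral_add[OF c b(1)]])
    fix z
    show "indicator (upper_triangle \<epsilon>) z \<le> ?c z + ?b z"
    proof (cases "\<exists>p\<in>inner_cells h \<epsilon>. z \<in> cell h p")
      case True
      then obtain p where p: "p \<in> inner_cells h \<epsilon>" "z \<in> cell h p" by blast
      then show ?thesis
        using sum_indicator_cells[OF h p, of "\<lambda>_. 1"] by (auto simp: indicator_def)
    next
      case False
      then show ?thesis
        using sum_indicator_outside_cells[of h \<epsilon> z "\<lambda>_. 1"] outside_inner_cells[OF h, of z \<epsilon>]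
        by (auto simp: indicator_def upper_triangle_def unit_square_def)
    qed
  qed
  with b(2) show "measure lebesgue (upper_triangle \<epsilon>) \<le> h\<^sup>2 * card (inner_cells h \<epsilon>) + 2 * h" by simp
qed

section \<open>Quadrature on one triangle\<close>

text \<open>
  The sum is the integral of a step function. Its difference from \<open>f\<close> is dominated by a
  function of the gap \<open>t\<close>: by \<open>B * t powr (- A)\<close> outside the squares, where the step function vanishes
  and \<open>t < \<epsilon> + 2 * h\<close>, and by \<open>2 * h * B * t powr (- A - 1)\<close> inside them, where \<open>t \<ge> \<epsilon>\<close>. The two error terms
  are the one-dimensional integrals of these bounds.
\<close>

lemma cell_sum_error:
  assumes f: "upper_growth A B f" and A: "0 < A" "A < 1" and h: "0 < h" and \<epsilon>: "0 < \<epsilon>"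
  shows "\<bar>h\<^sup>2 * (\<Sum>p\<in>inner_cells h \<epsilon>. f (corner h p)) - (LINT z:strict_upper|lborel. f z)\<bar>
    \<le> B * (\<epsilon> + 2 * h) powr (1 - A) / (1 - A) + 2 * h * B * \<epsilon> powr (- A) / A"
proof -
  let ?w = "\<lambda>t. B * (indicator {0..\<epsilon> + 2 * h} t * t powr (- A)) + 2 * h * B * (indicator {\<epsilon>..} t * t powr (- A - 1))"
  let ?I = "B * ((\<epsilon> + 2 * h) powr (1 - A) / (1 - A)) + 2 * h * B * (\<epsilon> powr (- A) / A)"
  let ?s = "\<lambda>z. \<Sum>p\<in>inner_cells h \<epsilon>. f (corner h p) * indicator (cell h p) z"
  let ?f = "\<lambda>z. indicator strict_upper z *\<^sub>R f z"
  let ?W = "\<lambda>z. indicator unit_square z *\<^sub>R ?w (snd z - fst z)"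
  note B = upper_growth_nonneg[OF f]
  have w: "has_bochner_integral lborel ?w ?I"
    by (rule has_bochner_integral_add[OF
          has_bochner_integral_mult_right[OF has_bochner_integral_powr_near_0]
          has_bochner_integral_mult_right[OF has_bochner_integral_powr_tail]])
       (use A h \<epsilon> in simp_all)
  have w0: "0 \<le> ?w t" for t using B h by (auto simp: indicator_def)
  note gap = gap_integral[of ?w, OF _ w0, unfolded set_integrable_def set_lebesgue_integral_def]
  have W: "integrable lborel ?W" "integral\<^sup>L lborel ?W \<le> ?I"
    using gap w by (auto simp: has_bochner_integral_iff)
  note s = has_bochner_integral_cell_step[OF h, of "\<lambda>p. f (corner h p)" \<epsilon>]
  have fi: "integrable lborel ?f"
    using upper_growth_set_integrable[OF f A] unfolding set_integrable_def .
  have pointwise: "\<bar>?s z - ?f z\<bar> \<le> ?W z" for z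
  proof (cases "\<exists>p\<in>inner_cells h \<epsilon>. z \<in> cell h p")
    case True
    then obtain p where p: "p \<in> inner_cells h \<epsilon>" "z \<in> cell h p" by blast
    define \<delta> where "\<delta> = snd z - fst z"
    have z: "z \<in> unit_square" "\<epsilon> \<le> \<delta>" "z \<in> strict_upper"
      using inner_cell_upper_triangle[OF h \<epsilon> p(1)] p(2) \<epsilon>
      by (auto simp: upper_triangle_def strict_upper_def unit_square_def \<delta>_def)
    have c: "0 \<le> real (fst p) * h" "real (fst p) * h \<le> fst z" "fst z \<le> real (fst p) * h + h"
      "1 - real (snd p) * h - h \<le> snd z" "snd z \<le> 1 - real (snd p) * h" "0 \<le> real (snd p) * h"
      using p h by (auto simp: cell_def algebra_simps)
    have "\<bar>f (corner h p) - f (fst z, snd z)\<bar> \<le> B * \<delta> powr (- A - 1) *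
        (\<bar>real (fst p) * h - fst z\<bar> + \<bar>1 - real (snd p) * h - snd z\<bar>)"
      unfolding corner_def
      using z(2) z(3)[unfolded strict_upper_def mem_Collect_eq] \<epsilon> c
      by (intro upper_growth_lipschitz[OF f A(1)]) (unfold \<delta>_def, linarith+)
    also have "\<dots> \<le> B * \<delta> powr (- A - 1) * (2 * h)"
      using c B by (intro mult_left_mono) auto
    also have "\<dots> \<le> ?W z"
      using z B by (auto simp: \<delta>_def[symmetric] algebra_simps)
    finally show ?thesis
      using sum_indicator_cells[OF h p, of "\<lambda>p. f (corner h p)"] z by simp
  next
    case False
    then have s0: "?s z = 0" using sum_indicator_outside_cells[of h \<epsilon> z] by auto
    show ?thesis
    proof (cases "z \<in> strict_upper")
      case True
      then have z: "0 \<le> fst z" "fst z < snd z" "snd z \<le> 1" by (auto simp: strict_upper_def)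
      have "\<bar>f (fst z, snd z)\<bar> \<le> B * (snd z - fst z) powr (- A)"
        using f z unfolding upper_growth_def by blast
      also have "\<dots> \<le> ?W z"
        using z outside_inner_cells[OF h, of z \<epsilon>] False B h
        by (auto simp: indicator_def unit_square_def mem_Times_iff)
      finally show ?thesis using s0 True by simp
    next
      case False
      then show ?thesis using s0 w0[of "snd z - fst z"] by (simp add: indicator_def)
    qed
  qed
  have "\<bar>integral\<^sup>L lborel ?s - integral\<^sup>L lborel ?f\<bar> = \<bar>integral\<^sup>L lborel (\<lambda>z. ?s z - ?f z)\<bar>"
    using s fi by (subst Bochner_Integration.integral_diff) (auto simp: has_bochner_integral_iff)
  also have "\<dots> \<le> integral\<^sup>L lborel ?W"
    using s fi W(1) pointwise by (intro integral_abs_bound_integral) (auto simp: has_bochner_integral_iff)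
  also note W(2)
  finally show ?thesis
    using s by (simp add: has_bochner_integral_iff set_lebesgue_integral_def)
qed

text \<open>
  Positivity is needed to make the grid side positive; the triangle contains one square of
  side \<open>(1 - \<epsilon>) / 2\<close>.
\<close>

lemma measure_upper_triangle:
  assumes "0 < \<epsilon>" "\<epsilon> < 1"
  shows "0 < measure lebesgue (upper_triangle \<epsilon>)" "measure lebesgue (upper_triangle \<epsilon>) \<le> 1"
proof -
  have "(0, 0) \<in> inner_cells ((1 - \<epsilon>) / 2) \<epsilon>" by (simp add: inner_cells_def)
  then have "0 < card (inner_cells ((1 - \<epsilon>) / 2) \<epsilon>)"
    using finite_inner_cells[of "(1 - \<epsilon>) / 2" \<epsilon>] assms by (auto simp: card_gt_0_iff)
  then have "0 < ((1 - \<epsilon>) / 2)\<^sup>2 * card (inner_cells ((1 - \<epsilon>) / 2) \<epsilon>)"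
    using assms by (intro mult_pos_pos) auto
  also have "\<dots> \<le> measure lebesgue (upper_triangle \<epsilon>)"
    using assms by (intro card_inner_cells) auto
  finally show "0 < measure lebesgue (upper_triangle \<epsilon>)" .
  have "measure lebesgue (upper_triangle \<epsilon>) \<le> measure lebesgue (cbox (0, 0) (1 :: real, 1 :: real))"
    using upper_triangle_borel[of \<epsilon>] upper_triangle_subset_cbox[of \<epsilon>]
    by (intro measure_mono_fmeasurable) auto
  also have "\<dots> = 1" by (simp add: content_Pair)
  finally show "measure lebesgue (upper_triangle \<epsilon>) \<le> 1" .
qed

text \<open>
  The points are chosen before the integrand: one quantifier block covers all \<open>A\<close>, \<open>B\<close> and \<open>f\<close>.
  Of the three summands of the constant, the first comes from the points near the diagonal outside
  the squares, the second from the variation of \<open>f\<close> within the squares and the third from the filler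
  points at \<open>(0, 1)\<close>.
\<close>

lemma upper_triangle_equal_weight_points:
  assumes \<epsilon>: "0 < \<epsilon>" "\<epsilon> < 1" and n: "0 < n"
  shows "\<exists>u. (\<forall>i\<in>{1..n}. u i \<in> upper_triangle \<epsilon>) \<and>
    (\<forall>A B f. 0 < A \<and> A < 1 \<and> upper_growth A B f \<and> 1 / sqrt (real n) \<le> \<epsilon> \<longrightarrow>
      \<bar>measure lebesgue (upper_triangle \<epsilon>) / real n * (\<Sum>i=1..n. f (u i)) - (LINT z:strict_upper|lborel. f z)\<bar>
        \<le> B * (3 / (1 - A) + 2 / A + 2) * \<epsilon> powr (1 - A))"
proof -
  define V where "V = measure lebesgue (upper_triangle \<epsilon>)"
  \<comment> \<open>With this side a square of the grid has exactly the weight of one sample point.\<close>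
  define h where "h = sqrt (V / real n)"
  define S where "S = inner_cells h \<epsilon>"
  note V = measure_upper_triangle[OF \<epsilon>, folded V_def]
  have h: "0 < h" "h\<^sup>2 = V / real n" using V n by (auto simp: h_def)
  have hn: "h \<le> 1 / sqrt (real n)"
    using V n by (simp add: h_def real_sqrt_divide divide_right_mono)
  note count = card_inner_cells[OF h(1) \<epsilon>(1), folded V_def S_def]
  have Vn: "V = h\<^sup>2 * real n" using n by (simp add: h(2))
  have card: "card S \<le> n" using count(1) h(1) by (simp add: Vn)
  have left: "h\<^sup>2 * real (n - card S) \<le> 2 * h"
    using count(2) card by (simp add: Vn of_nat_diff right_diff_distrib)
  obtain b where b: "bij_betw b {1..card S} S"
    using ex_bij_betw_nat_finite_1 finite_inner_cells[OF h(1)] unfolding S_def by blast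
  define u where "u i = (if i \<le> card S then corner h (b i) else (0, 1))" for i
  have "u i \<in> upper_triangle \<epsilon>" if "i \<in> {1..n}" for i
  proof (cases "i \<le> card S")
    case True
    with that b have "b i \<in> S" by (auto simp: bij_betw_def)
    then show ?thesis
      using True inner_cell_upper_triangle(2)[OF h(1) \<epsilon>(1)] by (simp add: u_def S_def)
  next
    case False
    then show ?thesis using \<epsilon> by (simp add: u_def upper_triangle_def unit_square_def)
  qed
  moreover have "\<bar>V / real n * (\<Sum>i=1..n. f (u i)) - (LINT z:strict_upper|lborel. f z)\<bar>
        \<le> B * (3 / (1 - A) + 2 / A + 2) * \<epsilon> powr (1 - A)"
    if A: "0 < A" "A < 1" and f: "upper_growth A B f" and en: "1 / sqrt (real n) \<le> \<epsilon>" for A B f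
  proof -
    note B = upper_growth_nonneg[OF f]
    have he: "h \<le> \<epsilon>" using hn en by linarith
    have "{1..n} = {1..card S} \<union> {card S<..n}" using card by auto
    then have "(\<Sum>i=1..n. f (u i)) = (\<Sum>i\<in>{1..card S}. f (u i)) + (\<Sum>i\<in>{card S<..n}. f (u i))"
      by (simp add: sum.union_disjoint ivl_disj_int)
    also have "(\<Sum>i\<in>{1..card S}. f (u i)) = (\<Sum>i\<in>{1..card S}. f (corner h (b i)))"
      by (intro sum.cong) (auto simp: u_def)
    also have "\<dots> = (\<Sum>p\<in>S. f (corner h p))"
      by (rule sum.reindex_bij_betw[OF b])
    also have "(\<Sum>i\<in>{card S<..n}. f (u i)) = real (n - card S) * f (0, 1)"
      by (simp add: u_def)
    finally have split: "V / real n * (\<Sum>i=1..n. f (u i))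
        = h\<^sup>2 * (\<Sum>p\<in>S. f (corner h p)) + h\<^sup>2 * real (n - card S) * f (0, 1)"
      by (simp add: h(2)[symmetric] algebra_simps)
    have scale: "\<epsilon> * \<epsilon> powr (- A) = \<epsilon> powr (1 - A)"
      using \<epsilon> powr_mult_base[of \<epsilon> "- A"] by simp
    have filler: "\<bar>h\<^sup>2 * real (n - card S) * f (0, 1)\<bar> \<le> 2 * B * \<epsilon> powr (1 - A)"
    proof -
      have "\<bar>f (0, 1)\<bar> \<le> B"
        using f[unfolded upper_growth_def, rule_format, of 0 1] by simp
      then have "\<bar>h\<^sup>2 * real (n - card S) * f (0, 1)\<bar> \<le> 2 * h * B"
        using mult_mono[OF left, of "\<bar>f (0, 1)\<bar>" B] h(1) by (simp add: abs_mult)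
      also have "2 * h * B \<le> 2 * \<epsilon> * B" using he B by (intro mult_right_mono) auto
      also have "\<epsilon> = \<epsilon> powr 1" using \<epsilon> by simp
      also have "2 * \<epsilon> powr 1 * B \<le> 2 * \<epsilon> powr (1 - A) * B"
        using \<epsilon> A B by (intro mult_right_mono mult_left_mono powr_mono') auto
      finally show ?thesis by (simp add: mult_ac)
    qed
    have near: "B * (\<epsilon> + 2 * h) powr (1 - A) / (1 - A) \<le> B * (3 / (1 - A)) * \<epsilon> powr (1 - A)"
    proof -
      have "(\<epsilon> + 2 * h) powr (1 - A) \<le> (3 * \<epsilon>) powr (1 - A)"
        using he h \<epsilon> A by (intro powr_mono2) auto
      also have "\<dots> = 3 powr (1 - A) * \<epsilon> powr (1 - A)" using \<epsilon> by (simp add: powr_mult)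
      also have "\<dots> \<le> 3 powr 1 * \<epsilon> powr (1 - A)"
        using A by (intro mult_right_mono powr_mono) auto
      finally have "B * (\<epsilon> + 2 * h) powr (1 - A) / (1 - A) \<le> B * (3 powr 1 * \<epsilon> powr (1 - A)) / (1 - A)"
        using A B by (intro divide_right_mono mult_left_mono) auto
      then show ?thesis by simp
    qed
    have far: "2 * h * B * \<epsilon> powr (- A) / A \<le> B * (2 / A) * \<epsilon> powr (1 - A)"
    proof -
      have "2 * h * B * \<epsilon> powr (- A) / A \<le> 2 * \<epsilon> * B * \<epsilon> powr (- A) / A"
        using he A B by (intro divide_right_mono mult_right_mono) auto
      also have "\<dots> = B * (2 / A) * \<epsilon> powr (1 - A)"
        by (simp add: scale[symmetric])
      finally show ?thesis .
    qed
    have "B * (3 / (1 - A) + 2 / A + 2) * \<epsilon> powr (1 - A) =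
      B * (3 / (1 - A)) * \<epsilon> powr (1 - A) + B * (2 / A) * \<epsilon> powr (1 - A) + 2 * B * \<epsilon> powr (1 - A)"
      by (simp only: distrib_left distrib_right mult_ac)
    then show ?thesis
      using cell_sum_error[OF f A h(1) \<epsilon>(1), folded S_def] filler near far split by linarith
  qed
  ultimately show ?thesis unfolding V_def by blast
qed

section \<open>Symmetry and the integral over the square\<close>

lemma has_bochner_integral_swap:
  fixes g :: "real \<times> real \<Rightarrow> real"
  assumes "has_bochner_integral lborel g x"
  shows "has_bochner_integral lborel (g \<circ> prod.swap) x"
proof -
  have swap: "(\<lambda>(x, y). g (y, x)) = g \<circ> prod.swap" by auto
  show ?thesis
    using assms lborel_pair.integrable_product_swap[of g] lborel_pair.integral_product_swap[of g]
      borel_measurable_integrable[of lborel g]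
    by (simp add: has_bochner_integral_iff lborel_prod swap)
qed

lemma indicator_lower_triangle: "indicator (lower_triangle \<epsilon>) = (indicator (upper_triangle \<epsilon>) \<circ> prod.swap :: _ \<Rightarrow> real)"
  by (auto simp: fun_eq_iff indicator_def upper_triangle_def lower_triangle_def unit_square_def)

lemma measure_lower_triangle:
  "measure lebesgue (lower_triangle \<epsilon>) = measure lebesgue (upper_triangle \<epsilon>)"
proof -
  have "has_bochner_integral lborel (indicator (lower_triangle \<epsilon>) :: _ \<Rightarrow> real) (measure lebesgue (upper_triangle \<epsilon>))"
    unfolding indicator_lower_triangle by (intro has_bochner_integral_swap has_bochner_integral_upper_triangle)
  moreover have "lower_triangle \<epsilon> \<in> sets borel"
  proof -
    have "lower_triangle \<epsilon> = {0..1} \<times> {0..1} \<inter> {z. snd z \<le> fst z - \<epsilon>}"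
      by (auto simp: lower_triangle_def unit_square_def)
    also have "\<dots> \<in> sets borel"
      by (intro sets.Int borel_closed closed_Times closed_Collect_le continuous_intros closed_atLeastAtMost)
    finally show ?thesis .
  qed
  ultimately show ?thesis
    by (auto simp: has_bochner_integral_iff)
qed

lemma negligible_diagonal: "negligible {z :: real \<times> real. fst z = snd z}"
  using negligible_hyperplane[of "(1, -1) :: real \<times> real" 0]
  by (simp add: inner_prod_def zero_prod_def)

text \<open>
  The diagonal is negligible. As \<open>f\<close> is arbitrary there, the integrand is first replaced by a Borel
  function that agrees with it off the diagonal.
\<close>

lemma square_integral_split:
  assumes f: "upper_growth A B f" "upper_growth A B (f \<circ> prod.swap)" and A: "0 < A" "A < 1"
  shows "square_integral f = (LINT z:strict_upper|lborel. f z) + (LINT z:strict_upper|lborel. (f \<circ> prod.swap) z)"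
proof -
  let ?F = "\<lambda>z. indicator strict_upper z *\<^sub>R f z"
  let ?G = "\<lambda>z. indicator strict_upper z *\<^sub>R (f \<circ> prod.swap) z"
  let ?H = "\<lambda>z. ?F z + (?G \<circ> prod.swap) z"
  let ?I = "(LINT z:strict_upper|lborel. f z) + (LINT z:strict_upper|lborel. (f \<circ> prod.swap) z)"
  have H: "has_bochner_integral lborel ?H ?I"
    using upper_growth_set_integrable[OF f(1) A] upper_growth_set_integrable[OF f(2) A]
    unfolding set_integrable_def set_lebesgue_integral_def
    by (intro has_bochner_integral_add has_bochner_integral_swap) (auto simp: has_bochner_integral_iff)
  then have "integrable lborel ?H" "integral\<^sup>L lborel ?H = ?I" by (auto simp: has_bochner_integral_iff)
  then have Hl: "integrable lebesgue ?H" "integral\<^sup>L lebesgue ?H = ?I"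
    by (auto simp: integrable_completion integral_completion)
  have supp: "indicator unit_square z *\<^sub>R ?H z = ?H z" for z
    by (auto simp: indicator_def strict_upper_def unit_square_def mem_Times_iff)
  have Hs: "set_integrable lebesgue unit_square ?H" "(LINT z:unit_square|lebesgue. ?H z) = ?I"
    using Hl by (simp_all only: set_integrable_def set_lebesgue_integral_def supp)
  have off: "f z = ?H z" if "z \<in> unit_square - {z. fst z = snd z}" for z
    using that by (cases z) (auto simp: indicator_def strict_upper_def unit_square_def)
  have fs: "set_integrable lebesgue unit_square f"
    by (rule absolutely_integrable_spike[OF Hs(1) negligible_diagonal off])
  have "integral unit_square f = integral unit_square ?H"
    by (rule integral_spike[OF negligible_diagonal]) (use off in auto)
  then show ?thesis
    unfolding square_integral_def
    using set_lebesgue_integral_eq_integral(2)[OF fs] set_lebesgue_integral_eq_integral(2)[OF Hs(1)] Hs(2) by simp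
qed

section \<open>Convergence rate\<close>

text \<open>
  The factor \<open>ln n\<close> absorbs the constant \<open>c\<close>: the comparison with \<open>1 / sqrt n\<close> holds as soon as
  \<open>ln n \<ge> (1 / c)\<^sup>2\<close>.
\<close>

lemma eps_eventually:
  assumes "0 < c"
  shows "\<forall>\<^sub>F n in sequentially. 2 \<le> n \<and> 0 < eps c n \<and> eps c n < 1 \<and> 1 / sqrt (real n) \<le> eps c n"
proof -
  have "(\<lambda>n. c * sqrt (ln (real n) / real n)) \<longlonglongrightarrow> c * sqrt 0"
    by (intro tendsto_intros lim_ln_over_n)
  then have 1: "\<forall>\<^sub>F n in sequentially. eps c n < 1"
    by (intro order_tendstoD(2)[of _ 0]) (auto simp: eps_def)
  have "filterlim (\<lambda>n. ln (real n)) at_top sequentially"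
    by (intro filterlim_compose[OF ln_at_top] filterlim_real_sequentially)
  then have 2: "\<forall>\<^sub>F n in sequentially. (1 / c)\<^sup>2 \<le> ln (real n)"
    by (simp add: filterlim_at_top)
  from 1 2 eventually_ge_at_top[of 2] show ?thesis
  proof eventually_elim
    case (elim n)
    have "1 / c \<le> sqrt (ln (real n))" using elim(2) by (rule real_le_rsqrt)
    then have "1 \<le> c * sqrt (ln (real n))" using assms by (simp add: field_simps)
    then have "1 / sqrt (real n) \<le> c * sqrt (ln (real n)) / sqrt (real n)"
      by (intro divide_right_mono) auto
    then show ?case
      using elim assms by (auto simp: eps_def real_sqrt_divide)
  qed
qed

theorem theorem1:
  fixes c :: real
  assumes "c > 0"
  shows "\<exists>(xu :: nat \<Rightarrow> nat \<Rightarrow> real \<times> real) (xd :: nat \<Rightarrow> nat \<Rightarrow> real \<times> real).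
    (\<forall>n. n \<ge> 2 \<and> eps c n < 1 \<longrightarrow>
       (\<forall>i \<in> {1..n}. xu n i \<in> upper_triangle (eps c n) \<and> xd n i \<in> lower_triangle (eps c n))) \<and>
    (\<forall>(A :: real) (f :: real \<times> real \<Rightarrow> real).
       0 < A \<and> A < 1 \<and> diagonal_singularity f A \<longrightarrow>
       (\<lambda>n. \<bar>two_triangle_estimate (eps c n) n (xu n) (xd n) f - square_integral f\<bar>)
         \<in> O(\<lambda>n. (ln (real n) / real n) powr ((1 - A) / 2)))"
proof -
  have pos: "0 < eps c n" if "2 \<le> n" for n
    using that assms by (simp add: eps_def)
  \<comment> \<open>Defined for each \<open>n\<close> separately, so that the points can be selected without reference to \<open>f\<close>.\<close>
  define good where "good n u \<longleftrightarrow> (\<forall>i\<in>{1..n}. u i \<in> upper_triangle (eps c n)) \<and>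
    (\<forall>A B f. 0 < A \<and> A < 1 \<and> upper_growth A B f \<and> 1 / sqrt (real n) \<le> eps c n \<longrightarrow>
      \<bar>measure lebesgue (upper_triangle (eps c n)) / real n * (\<Sum>i=1..n. f (u i)) - (LINT z:strict_upper|lborel. f z)\<bar>
        \<le> B * (3 / (1 - A) + 2 / A + 2) * eps c n powr (1 - A))" for n u
  have "\<exists>u. 2 \<le> n \<and> eps c n < 1 \<longrightarrow> good n u" for n
    unfolding good_def using upper_triangle_equal_weight_points[of "eps c n" n] pos[of n] by auto
  then obtain xu where xu: "\<And>n. 2 \<le> n \<Longrightarrow> eps c n < 1 \<Longrightarrow> good n (xu n)" by metis
  define xd where "xd n i = prod.swap (xu n i)" for n i
  have "(\<lambda>n. \<bar>two_triangle_estimate (eps c n) n (xu n) (xd n) f - square_integral f\<bar>)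
         \<in> O(\<lambda>n. (ln (real n) / real n) powr ((1 - A) / 2))"
    if A: "0 < A" "A < 1" and ds: "diagonal_singularity f A" for A f
  proof -
    obtain B where f: "upper_growth A B f" "upper_growth A B (f \<circ> prod.swap)"
      using diagonal_singularity_upper_growth[OF ds] .
    let ?C = "B * (3 / (1 - A) + 2 / A + 2)"
    have "\<forall>\<^sub>F n in sequentially. norm \<bar>two_triangle_estimate (eps c n) n (xu n) (xd n) f - square_integral f\<bar>
        \<le> (2 * ?C * c powr (1 - A)) * norm ((ln (real n) / real n) powr ((1 - A) / 2))"
      using eps_eventually[OF assms]
    proof eventually_elim
      case (elim n)
      then have g: "good n (xu n)" by (intro xu) auto
      have err: "\<bar>measure lebesgue (upper_triangle (eps c n)) / real n * (\<Sum>i=1..n. g (xu n i)) - (LINT z:strict_upper|lborel. g z)\<bar>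
        \<le> ?C * eps c n powr (1 - A)" if "upper_growth A B g" for g
        using g elim A that unfolding good_def by blast
      have "eps c n powr (1 - A) = c powr (1 - A) * (ln (real n) / real n) powr ((1 - A) / 2)"
        using assms elim by (simp add: eps_def powr_mult powr_half_sqrt[symmetric] powr_powr)
      then show ?case
        using err[OF f(1)] err[OF f(2)]
        by (simp add: two_triangle_estimate_def square_integral_split[OF f A] measure_lower_triangle xd_def comp_def
            mult.assoc)
    qed
    then show ?thesis by (rule bigoI)
  qed
  moreover have "xu n i \<in> upper_triangle (eps c n) \<and> xd n i \<in> lower_triangle (eps c n)"
    if "2 \<le> n" "eps c n < 1" "i \<in> {1..n}" for n i
  proof -
    have "xu n i \<in> upper_triangle (eps c n)"
      using xu[OF that(1,2)] that(3) unfolding good_def by blast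
    then show ?thesis
      by (auto simp: xd_def upper_triangle_def lower_triangle_def unit_square_def mem_Times_iff le_diff_eq)
  qed
  ultimately show ?thesis by blast
qed

end
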